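(* Let $\mathbb{A}$ be a finite alphabet with a pair $\pi=(<_D,<_A)$ of distinct total orders, and let $u$ and $v$ be $\pi$-clustering words over $\mathbb{A}$. If $u$ and $v$ do not have mixed order type, then $$i(u,v)=|\Delta(u,v)|.$$ In particular, for all finite Sturmian words $u$ and $v$ over a binary alphabet (with its symmetric pair of orders) with Parikh vectors $(a,b)$ and $(c,d)$ respectively, the index is $i(u,v)=|ad-bc|$.
   Context: For nonempty words $w,z$ put $w^\omega=www\cdots$ and $w^{-\omega}=\cdots www$. Write $w<_D z$ if $w^\omega$ is lexicographically smaller than $z^\omega$ with respect to $<_D$ (reading left to right), and $w<_A z$ if $w^{-\omega}$ is reverse-lexicographically smaller than $z^{-\omega}$ with respect to $<_A$ (reading right to left). A nonempty word $u$ is $\pi$-clustering if for all conjugates (cyclic rotations) $u',u''$ of $u$, $u'<_A u''\Leftrightarrow u'<_D u''$. $\Omega=(\Omega_{a,b})_{a,b\in\mathbb{A}}$ is the matrix with $\Omega_{a,b}=+1$ if $b<_A a$ and $a<_D b$; $\Omega_{a,b}=-1$ if $b<_D a$ and $a<_A b$; $0$ otherwise. $\Delta(u,v)=\lambda(u)^T\Omega\lambda(v)$, where $\lambda(w)=(|w|_a)_{a\in\mathbb{A}}$ is the Parikh vector of $w$ ($|w|_a$ is the number of occurrences of $a$ in $w$). Write $u=u_1\cdots u_s$, $v=v_1\cdots v_r$, indices of $u$ modulo $s$ and of $v$ modulo $r$; $u_{j+1}\cdots u_j$ denotes the conjugate $u_{j+1}\cdots u_su_1\cdots u_j$, and similarly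 $v_{i+1}\cdots v_i$. Let $R=\{(i,j):1\le i\le r,1\le j\le s\}$, $$T_1(u,v)=\{(i,j)\in R: v_i\ne u_j,\ u_{j+1}\cdots u_j<_A v_{i+1}\cdots v_i<_D u_{j+1}\cdots u_j\},$$ $$T_2(u,v)=\{(i,j)\in R: v_{i+1}\ne u_{j+1},\ v_{i+1}\cdots v_i<_A u_{j+1}\cdots u_j<_D v_{i+1}\cdots v_i\}.$$ The index is $i(u,v)=|T_1(u,v)|+|T_2(u,v)|$. The words $u,v$ have mixed order type if $T_1(u,v)$ and $T_2(u,v)$ are both nonempty. A finite Sturmian word is a nonempty word $u\in\{0,1\}^*$ whose language $L_u$ (the set of all finite factors of $u^\omega$) is balanced: if $axa,bxb\in L_u$ with $a,b\in\{0,1\}$ and $x\in\{0,1\}^*$, then $a=b$. The symmetric pair of orders on $\{0,1\}$ is $0<_D1$, $1<_A0$. *)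

theory Defs
  imports "HOL-Library.Omega_Words_Fun" "HOL-Library.Z2"
begin

text \<open>
  Finite words are lists; the alphabet is the whole (finite) letter type. A pair of orders consists
  of two strict total orders \<open>D\<close>, \<open>A\<close> on the letters, given as relations.
\<close>

definition omega_less :: "'a rel \<Rightarrow> 'a word \<Rightarrow> 'a word \<Rightarrow> bool" where
  "omega_less r x y \<longleftrightarrow> (\<exists>n. (\<forall>m<n. x m = y m) \<and> (x n, y n) \<in> r)"

definition less_D :: "'a rel \<Rightarrow> 'a list \<Rightarrow> 'a list \<Rightarrow> bool" where
  "less_D D w z \<longleftrightarrow> omega_less D (w\<^sup>\<omega>) (z\<^sup>\<omega>)"

text \<open>
  The left-infinite word \<open>\<cdots>www\<close> read from right to left is the right-infinite
  word \<open>(rev w)\<^sup>\<omega>\<close>.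
\<close>

definition less_A :: "'a rel \<Rightarrow> 'a list \<Rightarrow> 'a list \<Rightarrow> bool" where
  "less_A A w z \<longleftrightarrow> omega_less A ((rev w)\<^sup>\<omega>) ((rev z)\<^sup>\<omega>)"

definition conjugates :: "'a list \<Rightarrow> 'a list set" where
  "conjugates u = {rotate k u | k. True}"

definition clustering :: "'a rel \<Rightarrow> 'a rel \<Rightarrow> 'a list \<Rightarrow> bool" where
  "clustering D A u \<longleftrightarrow> u \<noteq> [] \<and>
     (\<forall>u'\<in>conjugates u. \<forall>u''\<in>conjugates u. less_A A u' u'' \<longleftrightarrow> less_D D u' u'')"

definition parikh :: "'a list \<Rightarrow> 'a \<Rightarrow> int" where
  "parikh w a = int (count_list w a)"

definition Omega :: "'a rel \<Rightarrow> 'a rel \<Rightarrow> 'a \<Rightarrow> 'a \<Rightarrow> int" where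
  "Omega D A a b =
     (if (b, a) \<in> A \<and> (a, b) \<in> D then 1
      else if (b, a) \<in> D \<and> (a, b) \<in> A then -1
      else 0)"

definition Delta :: "'a::finite rel \<Rightarrow> 'a rel \<Rightarrow> 'a list \<Rightarrow> 'a list \<Rightarrow> int" where
  "Delta D A u v = (\<Sum>a\<in>UNIV. \<Sum>b\<in>UNIV. parikh u a * Omega D A a b * parikh v b)"

text \<open>
  Letters of \<open>w\<close> are indexed cyclically from \<open>1\<close>: \<open>letter w i\<close> is \<open>w\<^sub>i\<close> for \<open>i \<ge> 1\<close>. The conjugate
  \<open>w\<^sub>i\<^sub>+\<^sub>1\<cdots>w\<^sub>i\<close> is \<open>rotate i w\<close>.
\<close>

definition letter :: "'a list \<Rightarrow> nat \<Rightarrow> 'a" where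
  "letter w i = w ! ((i - 1) mod length w)"

definition T1 :: "'a rel \<Rightarrow> 'a rel \<Rightarrow> 'a list \<Rightarrow> 'a list \<Rightarrow> (nat \<times> nat) set" where
  "T1 D A u v = {(i, j) \<in> {1..length v} \<times> {1..length u}.
     letter v i \<noteq> letter u j \<and>
     less_A A (rotate j u) (rotate i v) \<and> less_D D (rotate i v) (rotate j u)}"

definition T2 :: "'a rel \<Rightarrow> 'a rel \<Rightarrow> 'a list \<Rightarrow> 'a list \<Rightarrow> (nat \<times> nat) set" where
  "T2 D A u v = {(i, j) \<in> {1..length v} \<times> {1..length u}.
     letter v (i + 1) \<noteq> letter u (j + 1) \<and>
     less_A A (rotate i v) (rotate j u) \<and> less_D D (rotate j u) (rotate i v)}"

definition index :: "'a rel \<Rightarrow> 'a rel \<Rightarrow> 'a list \<Rightarrow> 'a list \<Rightarrow> nat" where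
  "index D A u v = card (T1 D A u v) + card (T2 D A u v)"

definition mixed_order_type :: "'a rel \<Rightarrow> 'a rel \<Rightarrow> 'a list \<Rightarrow> 'a list \<Rightarrow> bool" where
  "mixed_order_type D A u v \<longleftrightarrow> T1 D A u v \<noteq> {} \<and> T2 D A u v \<noteq> {}"

definition language :: "'a list \<Rightarrow> 'a list set" where
  "language u = {u\<^sup>\<omega> [i \<rightarrow> j] | i j. True}"

text \<open>The type \<open>bit\<close> serves only as the binary alphabet \<open>{0, 1}\<close>; its arithmetic is not used.\<close>

instance bit :: finite
proof
  have "(UNIV :: bit set) \<subseteq> {0, 1}" by auto
  then show "finite (UNIV :: bit set)" by (rule finite_subset) simp
qed

definition balanced :: "bit list set \<Rightarrow> bool" where
  "balanced L \<longleftrightarrow> (\<forall>a b x. [a] @ x @ [a] \<in> L \<and> [b] @ x @ [b] \<in> L \<longrightarrow> a = b)"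

definition finite_sturmian :: "bit list \<Rightarrow> bool" where
  "finite_sturmian u \<longleftrightarrow> u \<noteq> [] \<and> balanced (language u)"

definition sym_D :: "bit rel" where "sym_D = {(0, 1)}"

definition sym_A :: "bit rel" where "sym_A = {(1, 0)}"

end

theory Submission
  imports Defs
begin

text \<open>
  Both parts rest on the signed identity \<open>\<Delta>(u,v) = |T\<^sub>2(u,v)| - |T\<^sub>1(u,v)|\<close>
  (\<open>Delta_eq_card_T2_minus_card_T1\<close>): if one of the two sets is empty, the absolute value of the
  right-hand side is the index.

  For the identity, extend \<open>u\<close> and \<open>v\<close> to bi-infinite periodic words \<open>y\<close> and \<open>x\<close>, and read a pair
  \<open>(i,j)\<close> as a way to cut \<open>x\<close> before \<open>x\<^sub>i\<close> and \<open>y\<close> before \<open>y\<^sub>j\<close>. The two cut words are compared to the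
  right by \<open><\<^sub>D\<close> and to the left by \<open><\<^sub>A\<close>, giving signs \<open>SD(i,j)\<close> and \<open>SA(i,j)\<close>. Moving both cuts one
  step to the right across equal letters changes neither sign. On the torus of all pairs, the
  diagonal orbits thus fall into blocks of consecutive cuts, separated by the places where the
  letters differ, and both signs are constant on a block. The sign \<open>SA\<close> of a block is decided by the
  differing letters before its first cut, \<open>SD\<close> by those after its last cut. Summing over all pairs
  of letters, \<open>2 \<Delta>\<close> is therefore the sum of \<open>SA + SD\<close> over all blocks, that is, twice the number of
  blocks with \<open>SA = SD = 1\<close> minus twice the number of those with \<open>SA = SD = -1\<close>. The set \<open>T\<^sub>2\<close> picks the
  last cut of each block of the former kind and \<open>T\<^sub>1\<close> the first cut of each block of the latter kind.
  Passing between first and last cuts of blocks is \<open>sum_block_starts_eq_ends\<close>.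

  For Sturmian words it remains to exclude mixed order type. An element of \<open>T\<^sub>1\<close> exhibits, around its
  block, a factor \<open>0p0\<close> of \<open>v\<^sup>\<omega>\<close> and a factor \<open>1p1\<close> of \<open>u\<^sup>\<omega>\<close>. In a balanced word any two factors of
  equal length differ by at most one in their number of ones (\<open>balanced_ones\<close>), and periodicity
  makes the mean number of ones lie strictly within one of each. So the frequency of ones is strictly
  smaller in \<open>v\<close> than in \<open>u\<close> (\<open>slope_less\<close>). An element of \<open>T\<^sub>2\<close> gives the opposite inequality.
\<close>

section \<open>Conjugates as cuts of a bi-infinite periodic word\<close>

text \<open>
  Integer positions let a cut move in either direction and be compared on both sides without reducing
  indices modulo the lengths of the words. Position \<open>0\<close> carries the first letter.
\<close>

definition biword :: "'a list \<Rightarrow> int \<Rightarrow> 'a" where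
  "biword w k = w ! nat (k mod int (length w))"

definition after_cut :: "(int \<Rightarrow> 'a) \<Rightarrow> int \<Rightarrow> 'a word" where
  "after_cut x i n = x (i + int n)"

definition before_cut :: "(int \<Rightarrow> 'a) \<Rightarrow> int \<Rightarrow> 'a word" where
  "before_cut x i n = x (i - 1 - int n)"

lemma biword_periodic: "biword w (k + int (length w)) = biword w k"
  by (simp add: biword_def)

lemma biword_of_nat: "w \<noteq> [] \<Longrightarrow> biword w (int n) = (w\<^sup>\<omega>) n"
  by (simp add: biword_def iter_def zmod_int[symmetric])

lemma letter_eq_biword: "i \<ge> 1 \<Longrightarrow> letter w i = biword w (int i - 1)"
proof -
  assume "i \<ge> 1"
  then have "int i - 1 = int (i - 1)" by simp
  then show ?thesis by (simp add: letter_def biword_def zmod_int[symmetric] del: of_nat_diff)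
qed

lemma iter_rotate: "w \<noteq> [] \<Longrightarrow> (rotate i w)\<^sup>\<omega> = after_cut (biword w) (int i)"
proof (rule ext)
  fix n assume "w \<noteq> []"
  have "((i + n mod length w) mod length w) = (i + n) mod length w"
    by (simp add: mod_add_right_eq)
  then show "((rotate i w)\<^sup>\<omega>) n = after_cut (biword w) (int i) n"
    using \<open>w \<noteq> []\<close>
    by (simp add: iter_def after_cut_def biword_def nth_rotate of_nat_add[symmetric]
        zmod_int[symmetric] del: of_nat_add)
qed

lemma iter_rev_rotate: "w \<noteq> [] \<Longrightarrow> (rev (rotate i w))\<^sup>\<omega> = before_cut (biword w) (int i)"
proof (rule ext)
  fix n assume w: "w \<noteq> []"
  let ?r = "length w"
  let ?m = "n mod ?r"
  have m: "?m < ?r" using w by simp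
  have "(int i - 1 - int n) mod int ?r = (int i + int ?r - 1 - int ?m) mod int ?r"
    unfolding zmod_int
    by (metis (no_types, opaque_lifting) add_diff_eq diff_add_eq mod_add_self2 mod_diff_right_eq)
  also have "\<dots> = int ((i + (?r - Suc ?m)) mod ?r)"
    using m by (simp add: zmod_int of_nat_diff Suc_le_eq algebra_simps)
  finally have "before_cut (biword w) (int i) n = w ! ((i + (?r - Suc ?m)) mod ?r)"
    by (simp add: before_cut_def biword_def)
  moreover have "((rev (rotate i w))\<^sup>\<omega>) n = rotate i w ! (?r - Suc ?m)"
    using w m by (simp add: iter_def rev_nth)
  ultimately show "((rev (rotate i w))\<^sup>\<omega>) n = before_cut (biword w) (int i) n"
    using w m by (simp add: nth_rotate)
qed

lemma less_D_rotate:
  "w \<noteq> [] \<Longrightarrow> z \<noteq> [] \<Longrightarrow> less_D D (rotate i w) (rotate j z) \<longleftrightarrow>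
     omega_less D (after_cut (biword w) (int i)) (after_cut (biword z) (int j))"
  by (simp add: less_D_def iter_rotate)

lemma less_A_rotate:
  "w \<noteq> [] \<Longrightarrow> z \<noteq> [] \<Longrightarrow> less_A A (rotate i w) (rotate j z) \<longleftrightarrow>
     omega_less A (before_cut (biword w) (int i)) (before_cut (biword z) (int j))"
  by (simp add: less_A_def iter_rev_rotate)

section \<open>Signs of comparisons\<close>

lemma omega_less_first_difference:
  assumes "irrefl r" "\<And>m. m < n \<Longrightarrow> f m = g m" "f n \<noteq> g n"
  shows "omega_less r f g \<longleftrightarrow> (f n, g n) \<in> r"
proof
  assume "omega_less r f g"
  then obtain k where k: "\<forall>m<k. f m = g m" "(f k, g k) \<in> r"
    by (auto simp: omega_less_def)
  have "f k \<noteq> g k" using k(2) assms(1) by (auto simp: irrefl_def)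
  then have "k = n" using k(1) assms(2,3) by (metis linorder_neqE_nat)
  then show "(f n, g n) \<in> r" using k by simp
qed (use assms(2) in \<open>auto simp: omega_less_def\<close>)

definition omega_sign :: "'a rel \<Rightarrow> 'a word \<Rightarrow> 'a word \<Rightarrow> int" where
  "omega_sign r f g = of_bool (omega_less r f g) - of_bool (omega_less r g f)"

definition letter_sign :: "'a rel \<Rightarrow> 'a \<Rightarrow> 'a \<Rightarrow> int" where
  "letter_sign r a b = of_bool ((a, b) \<in> r) - of_bool ((b, a) \<in> r)"

lemma omega_sign_first_difference:
  assumes "irrefl r" "\<And>m. m < n \<Longrightarrow> f m = g m" "f n \<noteq> g n"
  shows "omega_sign r f g = letter_sign r (f n) (g n)"
  using omega_less_first_difference[of r n f g] omega_less_first_difference[of r n g f] assms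
  by (simp add: omega_sign_def letter_sign_def)

lemma omega_less_step:
  assumes "irrefl r" "f 0 = g 0"
  shows "omega_less r f g \<longleftrightarrow> omega_less r (\<lambda>n. f (Suc n)) (\<lambda>n. g (Suc n))"
proof
  assume "omega_less r f g"
  then obtain k where k: "\<forall>m<k. f m = g m" "(f k, g k) \<in> r"
    by (auto simp: omega_less_def)
  have "k \<noteq> 0" using k(2) assms by (auto simp: irrefl_def intro: Nat.gr0I)
  then obtain l where "k = Suc l" by (cases k) auto
  then show "omega_less r (\<lambda>n. f (Suc n)) (\<lambda>n. g (Suc n))"
    using k by (auto simp: omega_less_def)
next
  assume "omega_less r (\<lambda>n. f (Suc n)) (\<lambda>n. g (Suc n))"
  then obtain k where k: "\<forall>m<k. f (Suc m) = g (Suc m)" "(f (Suc k), g (Suc k)) \<in> r"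
    by (auto simp: omega_less_def)
  have "\<forall>m<Suc k. f m = g m" using k(1) assms(2) by (auto simp: less_Suc_eq_0_disj)
  then show "omega_less r f g" using k(2) by (auto simp: omega_less_def)
qed

lemma omega_sign_step:
  "irrefl r \<Longrightarrow> f 0 = g 0 \<Longrightarrow>
     omega_sign r f g = omega_sign r (\<lambda>n. f (Suc n)) (\<lambda>n. g (Suc n))"
  using omega_less_step[of r f g] omega_less_step[of r g f] by (simp add: omega_sign_def)

lemma letter_sign_total:
  "strict_linear_order r \<Longrightarrow> a \<noteq> b \<Longrightarrow> letter_sign r a b \<in> {1, -1}"
  unfolding strict_linear_order_on_def letter_sign_def
  by (auto simp: total_on_def irrefl_def dest: transD)

lemma omega_sign_cases:
  assumes "strict_linear_order r"
  shows "f \<noteq> g \<Longrightarrow> omega_sign r f g \<in> {1, -1}"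
    and "omega_sign r f g = 1 \<longleftrightarrow> omega_less r f g"
    and "omega_sign r f g = -1 \<longleftrightarrow> omega_less r g f"
proof -
  have irr: "irrefl r" using assms by (simp add: strict_linear_order_on_def)
  have sgn: "omega_sign r f g \<in> {1, -1}" if ne: "f \<noteq> g"
  proof -
    obtain k where "f k \<noteq> g k" using ne by auto
    define n where "n = (LEAST k. f k \<noteq> g k)"
    have n: "f n \<noteq> g n" unfolding n_def by (rule LeastI) fact
    have "f m = g m" if "m < n" for m
      using not_less_Least[OF that[unfolded n_def]] by blast
    then have "omega_sign r f g = letter_sign r (f n) (g n)"
      using omega_sign_first_difference[of r n f g] irr n by blast
    then show ?thesis using letter_sign_total[OF assms n] by simp
  qed
  then show "f \<noteq> g \<Longrightarrow> omega_sign r f g \<in> {1, -1}" .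
  have "\<not> omega_less r f g" if "f = g"
    using that irr by (auto simp: omega_less_def irrefl_def)
  then show "omega_sign r f g = 1 \<longleftrightarrow> omega_less r f g"
    and "omega_sign r f g = -1 \<longleftrightarrow> omega_less r g f"
    using sgn by (cases "f = g"; force simp: omega_sign_def of_bool_def split: if_splits)+
qed

lemma omega_sign_after_cut_step:
  assumes "irrefl r" "x i = y j"
  shows "omega_sign r (after_cut y (j + 1)) (after_cut x (i + 1)) =
         omega_sign r (after_cut y j) (after_cut x i)"
  using omega_sign_step[of r "after_cut y j" "after_cut x i"] assms
  by (simp add: after_cut_def[abs_def] algebra_simps)

lemma omega_sign_before_cut_step:
  assumes "irrefl r" "x i = y j"
  shows "omega_sign r (before_cut x (i + 1)) (before_cut y (j + 1)) =
         omega_sign r (before_cut x i) (before_cut y j)"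
  using omega_sign_step[of r "before_cut x (i + 1)" "before_cut y (j + 1)"] assms
  by (simp add: before_cut_def[abs_def] algebra_simps)

section \<open>Sums over the torus of cuts\<close>

lemma periodic_multiple:
  fixes x :: "int \<Rightarrow> 'a"
  assumes "\<And>k. x (k + p) = x k"
  shows "x (k + p * int n) = x k"
proof (induction n)
  case (Suc n)
  have "x (k + p * int (Suc n)) = x (k + p * int n + p)" by (simp add: algebra_simps)
  then show ?case using assms Suc by simp
qed simp

text \<open>
  Periodicity brings a difference just before the cut back to the right of it, at distance
  \<open>r s - 1\<close>. This makes \<open>SD\<close> nonzero on blocks that are known to have a beginning.
\<close>

lemma after_cut_neq:
  assumes "\<And>k. x (k + int r) = x k" "\<And>k. y (k + int s) = y k" "r > 0" "s > 0"
    and "x (i - 1) \<noteq> y (j - 1)"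
  shows "after_cut y j \<noteq> after_cut x i"
proof
  assume eq: "after_cut y j = after_cut x i"
  have "r * s > 0" using assms by simp
  then have n: "int (r * s - 1) = int r * int s - 1" by (simp add: of_nat_diff)
  have "x (i - 1) = x (i - 1 + int r * int s)" "y (j - 1) = y (j - 1 + int s * int r)"
    using periodic_multiple[of x "int r" "i - 1" s] periodic_multiple[of y "int s" "j - 1" r]
      assms(1,2) by simp_all
  moreover have "x (i + int (r * s - 1)) = y (j + int (r * s - 1))"
    using fun_cong[OF eq, of "r * s - 1"] by (simp add: after_cut_def)
  ultimately show False using assms(5) unfolding n by (simp add: algebra_simps)
qed

lemma sum_period_shift:
  fixes G :: "int \<Rightarrow> 'b::ab_group_add"
  assumes "\<And>k. G (k + int n) = G k"
  shows "(\<Sum>i\<in>{1..n}. G (int i + 1)) = (\<Sum>i\<in>{1..n}. G (int i))"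
proof -
  have "(\<Sum>i\<in>{1..m}. G (int i + 1)) = (\<Sum>i\<in>{1..m}. G (int i)) + G (int m + 1) - G 1" for m
    by (induction m) (simp_all add: algebra_simps)
  moreover have "G (int n + 1) = G 1" using assms[of 1] by (simp add: add.commute)
  ultimately show ?thesis by simp
qed

lemma sum_torus_shift:
  fixes F :: "int \<Rightarrow> int \<Rightarrow> 'b::ab_group_add"
  assumes "\<And>i j. F (i + int r) j = F i j" "\<And>i j. F i (j + int s) = F i j"
  shows "(\<Sum>i\<in>{1..r}. \<Sum>j\<in>{1..s}. F (int i + 1) (int j + 1)) =
         (\<Sum>i\<in>{1..r}. \<Sum>j\<in>{1..s}. F (int i) (int j))"
proof -
  have "(\<Sum>i\<in>{1..r}. \<Sum>j\<in>{1..s}. F (int i + 1) (int j + 1)) =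
        (\<Sum>i\<in>{1..r}. \<Sum>j\<in>{1..s}. F (int i + 1) (int j))"
    by (intro sum.cong refl sum_period_shift) (simp add: assms)
  also have "\<dots> = (\<Sum>i\<in>{1..r}. \<Sum>j\<in>{1..s}. F (int i) (int j))"
    by (rule sum_period_shift[of "\<lambda>i. \<Sum>j\<in>{1..s}. F i (int j)"]) (simp add: assms)
  finally show ?thesis .
qed

text \<open>
  Here \<open>P i j\<close> stands for the letters after the cut \<open>(i,j)\<close> being different, which makes \<open>(i,j)\<close> the last
  cut of its block, and \<open>P (i - 1) (j - 1)\<close> makes it the first one. The two sums have the same
  complement in the sum of \<open>F\<close> over the torus: off the last cuts, \<open>F\<close> keeps its value under a
  diagonal shift, which turns the cuts that are not last into those that are not first.
\<close>

lemma sum_block_starts_eq_ends: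
  fixes F :: "int \<Rightarrow> int \<Rightarrow> int" and P :: "int \<Rightarrow> int \<Rightarrow> bool"
  assumes "\<And>i j. F (i + int r) j = F i j" "\<And>i j. F i (j + int s) = F i j"
    and "\<And>i j. P (i + int r) j = P i j" "\<And>i j. P i (j + int s) = P i j"
    and const: "\<And>i j. \<not> P i j \<Longrightarrow> F (i + 1) (j + 1) = F i j"
  shows "(\<Sum>i\<in>{1..r}. \<Sum>j\<in>{1..s}. of_bool (P (int i - 1) (int j - 1)) * F (int i) (int j)) =
         (\<Sum>i\<in>{1..r}. \<Sum>j\<in>{1..s}. of_bool (P (int i) (int j)) * F (int i) (int j))"
proof -
  define H where "H i j = of_bool (P (i - 1) (j - 1)) * F i j - F i j" for i j
  have *: "P (i + int r - 1) j = P (i - 1) j" "P i (j + int s - 1) = P i (j - 1)" for i j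
    using assms(3)[of "i - 1" j] assms(4)[of i "j - 1"] by (simp_all add: algebra_simps)
  have "(\<Sum>i\<in>{1..r}. \<Sum>j\<in>{1..s}. H (int i) (int j)) =
        (\<Sum>i\<in>{1..r}. \<Sum>j\<in>{1..s}. H (int i + 1) (int j + 1))"
    by (rule sum_torus_shift[symmetric]) (simp_all add: H_def assms(1,2) *)
  also have "\<dots> = (\<Sum>i\<in>{1..r}. \<Sum>j\<in>{1..s}.
      of_bool (P (int i) (int j)) * F (int i) (int j) - F (int i) (int j))"
    by (intro sum.cong refl) (auto simp: H_def const)
  finally show ?thesis by (simp add: H_def sum_subtractf)
qed

section \<open>The signed identity\<close>

lemma sum_parikh:
  fixes f :: "'a::finite \<Rightarrow> int"
  shows "(\<Sum>a\<in>UNIV. parikh w a * f a) = (\<Sum>j\<in>{1..length w}. f (biword w (int j - 1)))"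
proof -
  have "(\<Sum>a\<in>UNIV. parikh w a * f a) = sum_list (map f w)"
  proof (induction w)
    case (Cons b w)
    have "(\<Sum>a\<in>UNIV. parikh (b # w) a * f a) =
          (\<Sum>a\<in>UNIV. parikh w a * f a + (if a = b then f a else 0))"
      by (intro sum.cong) (auto simp: parikh_def algebra_simps)
    then show ?case using Cons by (simp add: sum.distrib)
  qed (simp add: parikh_def)
  also have "\<dots> = (\<Sum>j<length w. f (w ! j))"
    by (simp add: sum_list_sum_nth atLeast0LessThan)
  also have "\<dots> = (\<Sum>j<length w. f (biword w (int (Suc j) - 1)))"
    by (intro sum.cong) (auto simp: biword_def)
  also have "\<dots> = (\<Sum>j\<in>{1..length w}. f (biword w (int j - 1)))"
    by (rule sum.reindex_bij_witness[of _ "\<lambda>j. j - 1" Suc]) auto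
  finally show ?thesis .
qed

lemma Delta_eq_sum:
  "Delta D A u v = (\<Sum>i\<in>{1..length v}. \<Sum>j\<in>{1..length u}.
     Omega D A (biword u (int j - 1)) (biword v (int i - 1)))"
proof -
  have "Delta D A u v = (\<Sum>a\<in>UNIV. parikh u a * (\<Sum>b\<in>UNIV. parikh v b * Omega D A a b))"
    unfolding Delta_def sum_distrib_left by (intro sum.cong refl) (simp add: ac_simps)
  then show ?thesis
    unfolding sum_parikh by (subst sum.swap) simp
qed

text \<open>
  \<open>\<Omega>\<close> is the average of two signs, one for each order; this splits \<open>2 \<Delta>\<close> into the part seen by \<open>SA\<close>
  and the part seen by \<open>SD\<close>.
\<close>

lemma two_Omega:
  assumes "strict_linear_order D" "strict_linear_order A"
  shows "2 * Omega D A a b =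
    of_bool (b \<noteq> a) * letter_sign A b a + of_bool (b \<noteq> a) * letter_sign D a b"
  using assms unfolding strict_linear_order_on_def Omega_def letter_sign_def
  by (auto simp: total_on_def irrefl_def dest: transD)

lemma card_eq_double_sum:
  fixes Q :: "nat \<Rightarrow> nat \<Rightarrow> bool"
  assumes "finite I" "finite J"
  shows "int (card {(i, j) \<in> I \<times> J. Q i j}) = (\<Sum>i\<in>I. \<Sum>j\<in>J. of_bool (Q i j))"
proof -
  have "{(i, j) \<in> I \<times> J. Q i j} = {p \<in> I \<times> J. case_prod Q p}" by auto
  then have "int (card {(i, j) \<in> I \<times> J. Q i j}) = (\<Sum>p\<in>I \<times> J. of_bool (case_prod Q p))"
    using assms by (simp add: of_bool_def sum.If_cases Int_def)
  then show ?thesis by (simp add: sum.cartesian_product case_prod_beta)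
qed

text \<open>
  The sum for \<open>2 \<Delta>\<close> is brought to the first cuts of all blocks, since there both signs are known to be
  nonzero, so that \<open>SA + SD\<close> is twice a difference of indicators.
\<close>

theorem Delta_eq_card_T2_minus_card_T1:
  fixes D :: "'a::finite rel"
  assumes D: "strict_linear_order D" and A: "strict_linear_order A"
    and u: "u \<noteq> []" and v: "v \<noteq> []"
  shows "Delta D A u v = int (card (T2 D A u v)) - int (card (T1 D A u v))"
proof -
  define r s where "r = length v" and "s = length u"
  define x y where "x = biword v" and "y = biword u"
  define SA where "SA i j = omega_sign A (before_cut x i) (before_cut y j)" for i j
  define SD where "SD i j = omega_sign D (after_cut y j) (after_cut x i)" for i j
  define P where "P i j \<longleftrightarrow> x i \<noteq> y j" for i j
  define f g :: "int \<Rightarrow> int \<Rightarrow> int"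
    where "f i j = of_bool (SA i j = 1 \<and> SD i j = 1)"
      and "g i j = of_bool (SA i j = -1 \<and> SD i j = -1)" for i j
  let ?S = "\<lambda>F :: int \<Rightarrow> int \<Rightarrow> int. \<Sum>i\<in>{1..r}. \<Sum>j\<in>{1..s}. F (int i) (int j)"
  have irr: "irrefl D" "irrefl A" using D A by (auto simp: strict_linear_order_on_def)
  have pos: "r > 0" "s > 0" using u v by (auto simp: r_def s_def)
  have xper: "x (k + int r) = x k" and yper: "y (k + int s) = y k" for k
    by (simp_all add: x_def y_def r_def s_def biword_periodic)
  have cper: "after_cut x (k + int r) = after_cut x k" "before_cut x (k + int r) = before_cut x k"
    "after_cut y (k + int s) = after_cut y k" "before_cut y (k + int s) = before_cut y k" for k
    using xper[of "k + int _"] xper[of "k - 1 - int _"]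
      yper[of "k + int _"] yper[of "k - 1 - int _"]
    by (auto simp: after_cut_def before_cut_def algebra_simps intro!: ext)
  have per: "P (i + int r) j = P i j" "P i (j + int s) = P i j"
    "SA (i + int r) j = SA i j" "SA i (j + int s) = SA i j"
    "SD (i + int r) j = SD i j" "SD i (j + int s) = SD i j" for i j
    by (simp_all add: P_def SA_def SD_def xper yper cper)
  have SA_const: "SA (i + 1) (j + 1) = SA i j" and SD_const: "SD (i + 1) (j + 1) = SD i j"
    if "\<not> P i j" for i j
    using that omega_sign_before_cut_step[OF irr(2), of x i y j]
      omega_sign_after_cut_step[OF irr(1), of x i y j]
    by (simp_all add: P_def SA_def SD_def)
  have ends: "?S (\<lambda>i j. of_bool (P (i - 1) (j - 1)) * F i j) = ?S (\<lambda>i j. of_bool (P i j) * F i j)"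
    if "\<And>i j. F (i + int r) j = F i j" "\<And>i j. F i (j + int s) = F i j"
      "\<And>i j. \<not> P i j \<Longrightarrow> F (i + 1) (j + 1) = F i j" for F
    by (rule sum_block_starts_eq_ends) (simp_all add: per that)
  have SA_start: "letter_sign A (x (i - 1)) (y (j - 1)) = SA i j" if "P (i - 1) (j - 1)" for i j
    using omega_sign_first_difference[OF irr(2), of 0 "before_cut x i" "before_cut y j"] that
    by (simp add: SA_def P_def before_cut_def)
  have SD_end: "letter_sign D (y j) (x i) = SD i j" if "P i j" for i j
    using omega_sign_first_difference[OF irr(1), of 0 "after_cut y j" "after_cut x i"] that
    by (simp add: SD_def P_def after_cut_def)
  \<comment> \<open>\<open>Omega\<close> compares the letters before a cut, while \<open>SD\<close> is decided by those after it: shift the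
    sum by one to reach the last cuts, and return to the first cuts along the blocks.\<close>
  have SD_sum: "?S (\<lambda>i j. of_bool (P (i - 1) (j - 1)) * letter_sign D (y (j - 1)) (x (i - 1))) =
    ?S (\<lambda>i j. of_bool (P (i - 1) (j - 1)) * SD i j)" (is "?l = ?r")
  proof -
    let ?F = "\<lambda>i j. of_bool (P (i - 1) (j - 1)) * letter_sign D (y (j - 1)) (x (i - 1))"
    have sh: "x (i + int r - 1) = x (i - 1)" "y (i + int s - 1) = y (i - 1)" for i
      using xper[of "i - 1"] yper[of "i - 1"] by (simp_all add: algebra_simps)
    have "?l = (\<Sum>i\<in>{1..r}. \<Sum>j\<in>{1..s}. ?F (int i + 1) (int j + 1))"
      by (rule sum_torus_shift[of ?F, symmetric]) (simp_all add: sh P_def)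
    also have "\<dots> = ?S (\<lambda>i j. of_bool (P i j) * SD i j)"
      by (intro sum.cong refl) (auto simp: SD_end)
    also have "\<dots> = ?r" by (rule ends[symmetric]) (simp_all add: per SD_const)
    finally show ?thesis .
  qed
  have "2 * Delta D A u v = ?S (\<lambda>i j. 2 * Omega D A (y (j - 1)) (x (i - 1)))"
    by (simp add: Delta_eq_sum r_def s_def x_def y_def sum_distrib_left)
  also have "\<dots> = ?S (\<lambda>i j. of_bool (P (i - 1) (j - 1)) * letter_sign A (x (i - 1)) (y (j - 1)))
      + ?S (\<lambda>i j. of_bool (P (i - 1) (j - 1)) * letter_sign D (y (j - 1)) (x (i - 1)))"
    unfolding two_Omega[OF D A] P_def by (simp add: sum.distrib)
  also have "\<dots> = ?S (\<lambda>i j. of_bool (P (i - 1) (j - 1)) * SA i j)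
      + ?S (\<lambda>i j. of_bool (P (i - 1) (j - 1)) * SD i j)"
    unfolding SD_sum by (intro arg_cong2[of _ _ _ _ "(+)"] sum.cong refl) (auto simp: SA_start)
  also have "\<dots> = ?S (\<lambda>i j. of_bool (P (i - 1) (j - 1)) * (SA i j + SD i j))"
    by (simp add: sum.distrib distrib_left)
  also have "\<dots> = ?S (\<lambda>i j. of_bool (P (i - 1) (j - 1)) * (2 * f i j - 2 * g i j))"
  proof -
    have "SA i j + SD i j = 2 * f i j - 2 * g i j" if q: "P (i - 1) (j - 1)" for i j
    proof -
      have "before_cut x i \<noteq> before_cut y j"
        using q by (auto simp: P_def before_cut_def dest!: fun_cong[of _ _ 0])
      then have "SA i j \<in> {1, -1}" using omega_sign_cases(1)[OF A] by (simp add: SA_def)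
      moreover have "after_cut y j \<noteq> after_cut x i"
        using after_cut_neq[of x r y s i j] xper yper pos q by (simp add: P_def)
      then have "SD i j \<in> {1, -1}" using omega_sign_cases(1)[OF D] by (simp add: SD_def)
      ultimately show ?thesis by (auto simp: f_def g_def)
    qed
    then show ?thesis by (intro sum.cong refl) simp
  qed
  also have "\<dots> = 2 * ?S (\<lambda>i j. of_bool (P (i - 1) (j - 1)) * f i j)
      - 2 * ?S (\<lambda>i j. of_bool (P (i - 1) (j - 1)) * g i j)"
    by (simp add: sum_subtractf sum_distrib_left right_diff_distrib mult.left_commute
        del: sum_mult_of_bool_eq sum_of_bool_mult_eq)
  also have "?S (\<lambda>i j. of_bool (P (i - 1) (j - 1)) * f i j) = ?S (\<lambda>i j. of_bool (P i j) * f i j)"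
    by (rule ends) (simp_all add: f_def per SA_const SD_const)
  also have "?S (\<lambda>i j. of_bool (P i j) * f i j) = int (card (T2 D A u v))"
    unfolding T2_def card_eq_double_sum[OF finite_atLeastAtMost finite_atLeastAtMost]
      r_def[symmetric] s_def[symmetric]
    using u v by (intro sum.cong refl)
      (auto simp: letter_eq_biword less_A_rotate less_D_rotate f_def P_def SA_def SD_def
        omega_sign_cases[OF A] omega_sign_cases[OF D] x_def y_def)
  also have "?S (\<lambda>i j. of_bool (P (i - 1) (j - 1)) * g i j) = int (card (T1 D A u v))"
    unfolding T1_def card_eq_double_sum[OF finite_atLeastAtMost finite_atLeastAtMost]
      r_def[symmetric] s_def[symmetric]
    using u v by (intro sum.cong refl)
      (auto simp: letter_eq_biword less_A_rotate less_D_rotate g_def P_def SA_def SD_def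
        omega_sign_cases[OF A] omega_sign_cases[OF D] x_def y_def)
  finally show ?thesis by simp
qed

corollary index_eq_abs_Delta:
  fixes D :: "'a::finite rel"
  assumes "strict_linear_order D" "strict_linear_order A" "u \<noteq> []" "v \<noteq> []"
    and "\<not> mixed_order_type D A u v"
  shows "int (index D A u v) = \<bar>Delta D A u v\<bar>"
  using Delta_eq_card_T2_minus_card_T1[OF assms(1-4)] assms(5)
  by (auto simp: index_def mixed_order_type_def)

section \<open>Sturmian words are not of mixed order type\<close>

definition ones :: "bit word \<Rightarrow> nat \<Rightarrow> nat \<Rightarrow> int" where
  "ones x i n = (\<Sum>t<n. of_bool (x (i + t) = 1))"

text \<open>
  Let \<open>d k\<close> be the surplus of ones among the first \<open>k\<close> letters from \<open>j\<close> over those from \<open>i\<close>. It moves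
  by steps \<open>-1, 0, 1\<close>. If it ever reaches \<open>2\<close>, then between its last visit to \<open>0\<close> and its first visit
  to \<open>2\<close> it steps up, stays at \<open>1\<close>, and steps up again, so that the two words spell \<open>1p1\<close> and \<open>0p0\<close>
  in the meantime.
\<close>

lemma balanced_ones:
  assumes bal: "balanced (language w)"
  shows "ones (w\<^sup>\<omega>) j n \<le> ones (w\<^sup>\<omega>) i n + 1"
proof (rule ccontr)
  define x where "x = w\<^sup>\<omega>"
  define d where "d k = ones x j k - ones x i k" for k
  assume "\<not> ones (w\<^sup>\<omega>) j n \<le> ones (w\<^sup>\<omega>) i n + 1"
  then have dn: "d n \<ge> 2" by (simp add: d_def x_def)
  have step: "d (Suc k) = d k + of_bool (x (j + k) = 1) - of_bool (x (i + k) = 1)" for k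
    by (simp add: d_def ones_def)
  have d0: "d 0 = 0" by (simp add: d_def ones_def)
  \<comment> \<open>\<open>N\<close> is the first time with \<open>d N = 2\<close>, and \<open>m\<close> the last time before it with \<open>d m = 0\<close>.\<close>
  define N where "N = (LEAST k. d k \<ge> 2)"
  have N: "d N \<ge> 2" unfolding N_def by (rule LeastI) (rule dn)
  have below: "d k \<le> 1" if "k < N" for k
    using not_less_Least[of k "\<lambda>k. d k \<ge> 2"] that by (simp add: N_def)
  obtain M where M: "N = Suc M" using N d0 by (cases N) auto
  define m where "m = Max {k. k \<le> M \<and> d k \<le> 0}"
  have fin: "finite {k. k \<le> M \<and> d k \<le> 0}" by simp
  have "{k. k \<le> M \<and> d k \<le> 0} \<noteq> {}" using d0 by (auto intro!: exI[of _ 0])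
  from Max_in[OF fin this] have m: "m \<le> M" "d m \<le> 0" unfolding m_def by blast+
  have above: "k \<le> m" if "k \<le> M" "d k \<le> 0" for k
    unfolding m_def using fin that by (intro Max_ge) auto
  have one: "d k = 1" if "m < k" "k \<le> M" for k
    using that above[of k] below[of k] M by force
  have last: "x (j + M) = 1 \<and> x (i + M) = 0" "d M = 1"
    using step[of M] N M below[of M] by (auto split: if_splits simp: of_bool_def)
  then have mM: "m < M" using m by (cases "m = M") auto
  have first: "x (j + m) = 1 \<and> x (i + m) = 0"
    using step[of m] one[of "Suc m"] mM m by (auto split: if_splits simp: of_bool_def)
  have mid: "x (j + k) = x (i + k)" if "m < k" "k < M" for k
    using step[of k] one[of "Suc k"] one[of k] that
    by (cases "x (j + k)"; cases "x (i + k)") auto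
  have split: "x [l + m \<rightarrow> l + Suc M] = [x (l + m)] @ x [l + Suc m \<rightarrow> l + M] @ [x (l + M)]" for l
    using mM by (simp add: subsequence_def upt_conv_Cons)
  have "x [j + Suc m \<rightarrow> j + M] = x [i + Suc m \<rightarrow> i + M]"
  proof (rule nth_equalityI)
    fix t assume "t < length (x [j + Suc m \<rightarrow> j + M])"
    then have "t < M - Suc m" by (simp add: subsequence_def)
    moreover from this have "x (j + Suc m + t) = x (i + Suc m + t)"
      using mid[of "Suc m + t"] by (simp add: add.assoc less_diff_conv)
    ultimately show "x [j + Suc m \<rightarrow> j + M] ! t = x [i + Suc m \<rightarrow> i + M] ! t"
      by (simp add: subsequence_def)
  qed (simp add: subsequence_def)
  moreover have "x [l + m \<rightarrow> l + Suc M] \<in> language w" for l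
    unfolding language_def x_def by auto
  ultimately have "[1] @ x [i + Suc m \<rightarrow> i + M] @ [1] \<in> language w"
    "[0] @ x [i + Suc m \<rightarrow> i + M] @ [0] \<in> language w"
    using split[of i] split[of j] first last by metis+
  then show False using bal unfolding balanced_def by (metis zero_neq_one)
qed

lemma sum_ones:
  assumes "w \<noteq> []"
  shows "(\<Sum>i\<in>{1..length w}. ones (w\<^sup>\<omega>) (i - 1) n) = int n * parikh w 1"
proof -
  define G :: "int \<Rightarrow> int" where "G k = of_bool (biword w (k - 1) = 1)" for k
  have per: "G (k + int (length w)) = G k" for k
    using biword_periodic[of w "k - 1"] by (simp add: G_def algebra_simps)
  have shift: "(\<Sum>i\<in>{1..length w}. G (int i + int t)) = (\<Sum>i\<in>{1..length w}. G (int i))" for t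
  proof (induction t)
    case (Suc t)
    then show ?case
      using sum_period_shift[of "\<lambda>k. G (k + int t)" "length w"] per[of "_ + int t"]
      by (simp add: algebra_simps)
  qed simp
  have G1: "(\<Sum>i\<in>{1..length w}. G (int i)) = parikh w 1"
  proof -
    have "(\<Sum>a\<in>UNIV. parikh w a * of_bool (a = 1)) = parikh w 1"
      by (simp add: of_bool_def if_distrib cong: if_cong)
    then show ?thesis unfolding sum_parikh G_def .
  qed
  have "(\<Sum>i\<in>{1..length w}. ones (w\<^sup>\<omega>) (i - 1) n) =
        (\<Sum>i\<in>{1..length w}. \<Sum>t<n. G (int i + int t))"
  proof (intro sum.cong refl)
    fix i assume "i \<in> {1..length w}"
    then have "int i + int t - 1 = int (i - 1 + t)" for t by auto
    then show "ones (w\<^sup>\<omega>) (i - 1) n = (\<Sum>t<n. G (int i + int t))"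
      using assms by (simp add: ones_def G_def biword_of_nat del: of_nat_add)
  qed
  also have "\<dots> = (\<Sum>t<n. parikh w 1)"
    by (subst sum.swap) (simp only: shift G1)
  finally show ?thesis by simp
qed

text \<open>
  Averaged over the starting positions in one period, the number of ones in a window of length \<open>n\<close>
  is \<open>n |w|\<^sub>1 / |w|\<close>. No window is further than one from any other, and a window agrees with itself,
  which makes both bounds strict.
\<close>

lemma balanced_slope_bounds:
  assumes "w \<noteq> []" "balanced (language w)"
  shows "int n * parikh w 1 > int (length w) * (ones (w\<^sup>\<omega>) k n - 1)"
    and "int n * parikh w 1 < int (length w) * (ones (w\<^sup>\<omega>) k n + 1)"
proof -
  let ?c = "ones (w\<^sup>\<omega>) k n"
  define i where "i = Suc (k mod length w)"
  have i: "i \<in> {1..length w}" using assms(1) by (simp add: i_def Suc_le_eq)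
  have c: "ones (w\<^sup>\<omega>) (i - 1) n = ?c"
    using assms(1) by (simp add: ones_def i_def iter_def mod_add_left_eq)
  have "(\<Sum>i\<in>{1..length w}. ?c - 1) < (\<Sum>i\<in>{1..length w}. ones (w\<^sup>\<omega>) (i - 1) n)"
    using balanced_ones[OF assms(2), of k n] i c
    by (intro sum_strict_mono_ex1) (auto intro!: bexI[of _ i] simp: algebra_simps)
  then show "int n * parikh w 1 > int (length w) * (?c - 1)"
    unfolding sum_ones[OF assms(1)] by simp
  have "(\<Sum>i\<in>{1..length w}. ones (w\<^sup>\<omega>) (i - 1) n) < (\<Sum>i\<in>{1..length w}. ?c + 1)"
    using balanced_ones[OF assms(2), of _ n k] i c
    by (intro sum_strict_mono_ex1) (auto intro!: bexI[of _ i] simp: algebra_simps)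
  then show "int n * parikh w 1 < int (length w) * (?c + 1)"
    unfolding sum_ones[OF assms(1)] by simp
qed

text \<open>
  Between the nearest difference to the left of the cut and the nearest one to the right, \<open>w\<close> reads
  \<open>0p0\<close> and \<open>z\<close> reads \<open>1p1\<close> with the same \<open>p\<close>. With \<open>c\<close> ones in \<open>p\<close>, the bounds on the slopes put the
  number \<open>c + 1\<close> strictly between the mean numbers of ones in windows of that length.
\<close>

lemma slope_less:
  fixes i j :: nat
  assumes w: "w \<noteq> []" "balanced (language w)" and z: "z \<noteq> []" "balanced (language z)"
    and before: "omega_less sym_A (before_cut (biword z) (int j)) (before_cut (biword w) (int i))"
    and after: "omega_less sym_D (after_cut (biword w) (int i)) (after_cut (biword z) (int j))"
  shows "parikh w 1 * int (length z) < parikh z 1 * int (length w)"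
proof -
  obtain m where m: "\<And>k. k < m \<Longrightarrow> biword z (int j - 1 - int k) = biword w (int i - 1 - int k)"
    "biword z (int j - 1 - int m) = 1" "biword w (int i - 1 - int m) = 0"
    using before by (auto simp: omega_less_def before_cut_def sym_A_def)
  obtain n where n: "\<And>k. k < n \<Longrightarrow> biword w (int i + int k) = biword z (int j + int k)"
    "biword w (int i + int n) = 0" "biword z (int j + int n) = 1"
    using after by (auto simp: omega_less_def after_cut_def sym_D_def)
  define W Z where "W t = biword w (int i - 1 - int m + int t)"
    and "Z t = biword z (int j - 1 - int m + int t)" for t
  define M where "M = m + n"
  have mid: "W (Suc t) = Z (Suc t)" if "t < M" for t
  proof (cases "t < m")
    case True
    then show ?thesis using m(1)[of "m - Suc t"] by (simp add: W_def Z_def of_nat_diff algebra_simps)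
  next
    case False
    then show ?thesis using n(1)[of "t - m"] that
      by (simp add: W_def Z_def M_def of_nat_diff algebra_simps)
  qed
  have ends: "W 0 = 0" "Z 0 = 1" "W (Suc M) = 0" "Z (Suc M) = 1"
    using m n by (simp_all add: W_def Z_def M_def algebra_simps)
  \<comment> \<open>The window may start at a negative position; \<open>m + 1\<close> periods bring it into the right-infinite
    word.\<close>
  have position: "\<exists>p. \<forall>t. (x\<^sup>\<omega>) (p + t) = biword x (int l - 1 - int m + int t)"
    if x: "x \<noteq> []" for x :: "bit list" and l :: nat
  proof -
    have "length x * Suc m \<ge> Suc m" using x by (cases "length x") auto
    then have "int (l + length x * Suc m - Suc m + t) =
        (int l - 1 - int m + int t) + int (length x) * int (Suc m)" for t
      by (simp add: of_nat_diff algebra_simps)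
    then have "(x\<^sup>\<omega>) (l + length x * Suc m - Suc m + t) = biword x (int l - 1 - int m + int t)" for t
      using biword_of_nat[OF x, of "l + length x * Suc m - Suc m + t"]
        periodic_multiple[of "biword x", OF biword_periodic] by metis
    then show ?thesis by blast
  qed
  obtain p where p: "\<And>t. (w\<^sup>\<omega>) (p + t) = W t" using position[OF w(1), of i] by (auto simp: W_def)
  obtain q where q: "\<And>t. (z\<^sup>\<omega>) (q + t) = Z t" using position[OF z(1), of j] by (auto simp: Z_def)
  define c :: int where "c = (\<Sum>t<M. of_bool (W (Suc t) = 1))"
  have window: "(\<Sum>t<Suc (Suc M). of_bool (X t = 1)) =
      of_bool (X 0 = 1) + (\<Sum>t<M. of_bool (X (Suc t) = 1)) + (of_bool (X (Suc M) = 1) :: int)"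
    for X :: "bit word"
    by (subst sum.lessThan_Suc_shift) simp
  have ones_w: "ones (w\<^sup>\<omega>) p (Suc (Suc M)) = c"
    unfolding ones_def p window by (simp add: ends c_def)
  have "(\<Sum>t<M. of_bool (Z (Suc t) = 1)) = c"
    unfolding c_def using mid by (intro sum.cong) auto
  then have ones_z: "ones (z\<^sup>\<omega>) q (Suc (Suc M)) = c + 2"
    unfolding ones_def q window by (simp add: ends)
  let ?n = "int (Suc (Suc M))"
  have "?n * parikh w 1 < int (length w) * (c + 1)"
    using balanced_slope_bounds(2)[OF w, of "Suc (Suc M)" p] ones_w by simp
  then have "?n * parikh w 1 * int (length z) < int (length w) * (c + 1) * int (length z)"
    using z(1) by (intro mult_strict_right_mono) auto
  moreover have "int (length z) * (c + 1) < ?n * parikh z 1"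
    using balanced_slope_bounds(1)[OF z, of q "Suc (Suc M)"] ones_z by (simp add: add.commute)
  then have "int (length z) * (c + 1) * int (length w) < ?n * parikh z 1 * int (length w)"
    using w(1) by (intro mult_strict_right_mono) auto
  ultimately have "?n * (parikh w 1 * int (length z)) < ?n * (parikh z 1 * int (length w))"
    by (simp only: ac_simps)
  then show ?thesis by (simp only: mult_less_cancel_left_pos of_nat_0_less_iff zero_less_Suc)
qed

lemma strict_linear_order_sym: "strict_linear_order sym_D" "strict_linear_order sym_A"
  by (auto simp: strict_linear_order_on_def sym_D_def sym_A_def trans_def irrefl_def total_on_def)

lemma finite_sturmian_not_mixed:
  assumes u: "finite_sturmian u" and v: "finite_sturmian v"
  shows "\<not> mixed_order_type sym_D sym_A u v"
proof
  have ne: "u \<noteq> []" "v \<noteq> []" and bal: "balanced (language u)" "balanced (language v)"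
    using u v by (auto simp: finite_sturmian_def)
  assume "mixed_order_type sym_D sym_A u v"
  then obtain i j i' j' where "(i, j) \<in> T1 sym_D sym_A u v" "(i', j') \<in> T2 sym_D sym_A u v"
    by (auto simp: mixed_order_type_def)
  then have "parikh v 1 * int (length u) < parikh u 1 * int (length v)"
    "parikh u 1 * int (length v) < parikh v 1 * int (length u)"
    using slope_less[OF ne(2) bal(2) ne(1) bal(1), of j i]
      slope_less[OF ne(1) bal(1) ne(2) bal(2), of i' j']
    by (auto simp: T1_def T2_def less_A_rotate less_D_rotate ne)
  then show False by simp
qed

lemma Delta_sym: "Delta sym_D sym_A u v = parikh u 0 * parikh v 1 - parikh u 1 * parikh v 0"
proof -
  have UNIV_bit: "(UNIV :: bit set) = {0, 1}" by auto
  show ?thesis by (simp add: Delta_def UNIV_bit Omega_def sym_D_def sym_A_def)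
qed

theorem corollary7:
  shows "(\<forall>(D :: 'a::finite rel) A u v.
            strict_linear_order D \<and> strict_linear_order A \<and> D \<noteq> A \<and>
            clustering D A u \<and> clustering D A v \<and> \<not> mixed_order_type D A u v \<longrightarrow>
            int (index D A u v) = \<bar>Delta D A u v\<bar>) \<and>
         (\<forall>u v a b c d.
            finite_sturmian u \<and> finite_sturmian v \<and>
            (parikh u 0, parikh u 1) = (a, b) \<and> (parikh v 0, parikh v 1) = (c, d) \<longrightarrow>
            int (index sym_D sym_A u v) = \<bar>a * d - b * c\<bar>)"
proof (intro conjI allI impI)
  fix D A :: "'a rel" and u v
  assume "strict_linear_order D \<and> strict_linear_order A \<and> D \<noteq> A \<and>
    clustering D A u \<and> clustering D A v \<and> \<not> mixed_order_type D A u v"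
  then show "int (index D A u v) = \<bar>Delta D A u v\<bar>"
    by (intro index_eq_abs_Delta) (simp_all add: clustering_def)
next
  fix u v a b c d
  assume *: "finite_sturmian u \<and> finite_sturmian v \<and>
    (parikh u 0, parikh u 1) = (a, b) \<and> (parikh v 0, parikh v 1) = (c, d)"
  have "u \<noteq> []" "v \<noteq> []" "\<not> mixed_order_type sym_D sym_A u v"
    using * finite_sturmian_not_mixed[of u v] by (auto simp: finite_sturmian_def)
  then have "int (index sym_D sym_A u v) = \<bar>Delta sym_D sym_A u v\<bar>"
    by (rule index_eq_abs_Delta[OF strict_linear_order_sym])
  then show "int (index sym_D sym_A u v) = \<bar>a * d - b * c\<bar>"
    using * by (simp add: Delta_sym)
qed

end
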